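(* Let $N\ge 1$, let $\Omega\subset\mathbb{R}^N$ be a nonempty connected open set, let $p,q>1$, and let $u,v$ be differentiable functions in $\Omega$ such that $u>0$, $v>0$. Assume that one of the following assumptions is satisfied: (i) $p\in I(q)$; (ii) $p\le q+1$ and $\nabla u\nabla v\ge 0$ in $\Omega$. Then, in $\Omega$, $$|\nabla u|^{p-2}\nabla u\nabla\left(\frac{v^{q}}{u^{q-1}}\right)\le |\nabla v|^{p-2}\nabla v\nabla\left(\frac{v^{q-p+1}}{u^{q-p}}\right).\qquad (\ast)$$ Moreover, if $p<q+1$ and $\nabla u\nabla v\ge 0$ in $\Omega$, then the equality in $(\ast)$ is satisfied in $\Omega$ if and only if $u\equiv kv$ for some constant $k>0$. Furthermore, the assumptions (i) and (ii) are optimal in the following sense: (I) if $p\notin I(q)$, then there exist differentiable functions $u,v>0$ in $\Omega$ and a point $x\in\Omega$ such that $(\ast)$ is violated at $x$; (II) if $p>q+1$, then there exist differentiable functions $u,v>0$ in $\Omega$ with $\nabla u\nabla v\ge 0$ in $\Omega$ and a point $x\in\Omega$ such that $(\ast)$ is violated at $x$.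
   Context: For $q>1$, define $$I(q):=\{p>1:\ (q-1)s^p+qs^{p-1}-(p-q)s+(q-p+1)\ge 0\ \text{ for all } s\ge 0\}.$$ The product of two gradients, such as $\nabla u\nabla v$, denotes the Euclidean scalar product in $\mathbb{R}^N$, and $|\cdot|$ is the Euclidean norm. For $p>1$, $|\xi|^{p-2}\xi$ is understood as $0$ when $\xi=0$. *)

theory Defs
  imports "HOL-Analysis.Analysis"
begin

definition grad :: "(real ^ 'n \<Rightarrow> real) \<Rightarrow> real ^ 'n \<Rightarrow> real ^ 'n" where
  "grad f x = (THE D. GDERIV f x :> D)"

lemma grad_eqI:
  assumes "GDERIV f x :> D"
  shows "grad f x = D"
  unfolding grad_def
proof (rule the_equality[where P = "\<lambda>D. GDERIV f x :> D", OF assms])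
  fix E assume "GDERIV f x :> E"
  then have "(\<lambda>h. h \<bullet> E) = (\<lambda>h. h \<bullet> D)"
    using assms has_derivative_unique unfolding gderiv_def by blast
  then have "\<And>h. h \<bullet> E = h \<bullet> D" by meson
  then show "E = D" by (metis vector_eq_ldot inner_commute)
qed

lemma gderiv_grad:
  assumes "f differentiable (at x)"
  shows "GDERIV f x :> grad f x"
proof -
  obtain f' where f': "(f has_derivative f') (at x)"
    using assms unfolding differentiable_def by blast
  then have "linear f'"
    by (simp add: bounded_linear.linear has_derivative_bounded_linear)
  then have "f' = (\<lambda>h. h \<bullet> adjoint f' 1)"
    by (simp add: adjoint_works fun_eq_iff)
  with f' have "GDERIV f x :> adjoint f' 1"
    unfolding gderiv_def by metis
  then show ?thesis
    using grad_eqI by metis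
qed

(* At \<xi> = 0 the value is 0 for every p, as "*\<^sub>R 0" annihilates the weight. *)
definition pflux :: "real \<Rightarrow> real ^ 'n \<Rightarrow> real ^ 'n" where
  "pflux p \<xi> = norm \<xi> powr (p - 2) *\<^sub>R \<xi>"

(* The library sets 0 powr a = 0; in I_set q both powr exponents p and p - 1 are positive,
   so this is the usual value at s = 0. *)
definition I_set :: "real \<Rightarrow> real set" where
  "I_set q = {p. p > 1 \<and>
     (\<forall>s\<ge>0. (q - 1) * s powr p + q * s powr (p - 1) - (p - q) * s + (q - p + 1) \<ge> 0)}"

definition picone_lhs ::
  "real \<Rightarrow> real \<Rightarrow> (real ^ 'n \<Rightarrow> real) \<Rightarrow> (real ^ 'n \<Rightarrow> real) \<Rightarrow> real ^ 'n \<Rightarrow> real" where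
  "picone_lhs p q u v x =
     pflux p (grad u x) \<bullet> grad (\<lambda>y. v y powr q / u y powr (q - 1)) x"

definition picone_rhs ::
  "real \<Rightarrow> real \<Rightarrow> (real ^ 'n \<Rightarrow> real) \<Rightarrow> (real ^ 'n \<Rightarrow> real) \<Rightarrow> real ^ 'n \<Rightarrow> real" where
  "picone_rhs p q u v x =
     pflux p (grad v x) \<bullet> grad (\<lambda>y. v y powr (q - p + 1) / u y powr (q - p)) x"

(* Functions on \<Omega> are represented by total functions; only their values on \<Omega> matter
   (for open \<Omega>, differentiability on \<Omega> and grad on \<Omega> depend on nothing else). *)
definition pos_diff_on :: "(real ^ 'n) set \<Rightarrow> (real ^ 'n \<Rightarrow> real) \<Rightarrow> bool" where
  "pos_diff_on \<Omega> u \<longleftrightarrow> u differentiable_on \<Omega> \<and> (\<forall>x\<in>\<Omega>. u x > 0)"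

end

theory Submission
  imports Defs
begin

text \<open>At a point, put \<open>a = (v / u) \<nabla>u\<close>, \<open>b = \<nabla>v\<close> and let \<open>c\<close> be the cosine of their angle.
  After division by \<open>(v / u) powr (q - p)\<close> the difference of the two sides is affine in \<open>c\<close>, so
  that only the end points of the range of \<open>c\<close> matter, and with \<open>s = \<bar>a\<bar> / \<bar>b\<bar>\<close> it is a positive multiple of
  \<open>(q - 1) s\<^sup>p + (q - p + 1) - c (q s\<^sup>p\<^sup>-\<^sup>1 + (q - p) s)\<close>.
  Non-negativity at \<open>c = - 1\<close> for all \<open>s\<close> is exactly \<open>p \<in> I q\<close>.  At \<open>c = 1\<close> the expression equals
  \<open>q (s\<^sup>p\<^sup>-\<^sup>1 - 1)(s - 1) - (s\<^sup>p - 1 - p (s - 1))\<close>, which is increasing in \<open>q\<close> and non-negative already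
  when \<open>q\<close> is replaced by \<open>max 1 (p - 1)\<close>, by a Bernoulli inequality.\<close>

section \<open>Bernoulli inequalities and the scalar inequality at cosine 1\<close>

text \<open>Weighted AM-GM for \<open>s\<close> and \<open>1\<close> with weights \<open>a\<close>
  and \<open>1 - a\<close>.\<close>

lemma powr_le_tangent_at_1:
  fixes s a :: real
  assumes "0 \<le> a" "a \<le> 1" "0 < s"
  shows "s powr a \<le> 1 + a * (s - 1)"
  using Youngs_inequality_0[of a "1 - a" s 1] assms by (simp add: algebra_simps)

lemma powr_minus_ge_tangent_at_1:
  fixes s a :: real
  assumes "0 \<le> a" "0 < s"
  shows "1 - a * (s - 1) \<le> s powr (- a)"
proof -
  have "a * ln s \<le> a * (s - 1)"
    using assms by (intro mult_left_mono ln_le_minus_one)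
  then have "1 - a * (s - 1) \<le> 1 + (- a * ln s)" by simp
  also have "\<dots> \<le> exp (- a * ln s)" by (rule exp_ge_add_one_self)
  finally show ?thesis using assms by (simp add: powr_def)
qed

lemma powr_minus_1_times_minus_1_pos:
  fixes s a :: real
  assumes "0 < a" "0 \<le> s" "s \<noteq> 1"
  shows "(s powr a - 1) * (s - 1) > 0"
proof (cases "s > 1")
  case True
  then have "1 powr a < s powr a" using assms by (intro powr_less_mono2) auto
  then show ?thesis using True by simp
next
  case False
  then have "s powr a < 1 powr a" using assms by (intro powr_less_mono2) auto
  then show ?thesis using False assms by (simp add: mult_neg_neg)
qed

text \<open>Since \<open>0 powr a = 0\<close> for every \<open>a\<close>, the identity survives at
  \<open>s = 0\<close> even for negative exponents. This covers \<open>p - 2\<close> when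
  \<open>p < 2\<close>, so vanishing gradients need no separate treatment here.\<close>

lemma powr_mult_self:
  fixes s a :: real
  assumes "0 \<le> s"
  shows "s powr (a - 1) * s = s powr a"
  using assms by (cases "s = 0") (auto simp: powr_diff)

lemma powr_minus_2_mult_square:
  fixes s a :: real
  assumes "0 \<le> s"
  shows "s powr (a - 2) * s\<^sup>2 = s powr a"
  using powr_mult_self[of s "a - 1"] powr_mult_self[of s a] assms
  by (simp add: power2_eq_square mult.assoc[symmetric])

text \<open>For \<open>p \<le> 2\<close> expanding both sides leaves the upper tangent bound for
  \<open>s powr (p - 1)\<close>. For \<open>p > 2\<close> it leaves
  \<open>(1 - (p - 2) * (s - 1)) * s powr (p - 1) \<le> s\<close>, which is the lower tangent bound
  for \<open>s powr (- (p - 2))\<close> multiplied by \<open>s powr (p - 1)\<close>.\<close>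

lemma powr_convexity_gap_le:
  fixes s p :: real
  assumes "p > 1" "0 \<le> s"
  shows "s powr p - 1 - p * (s - 1) \<le> max 1 (p - 1) * ((s powr (p - 1) - 1) * (s - 1))"
proof (cases "s = 0")
  case True
  then show ?thesis using assms by simp
next
  case False
  with assms have s: "s > 0" by simp
  have sp: "s powr p = s powr (p - 1) * s" using powr_mult_self assms by simp
  show ?thesis
  proof (cases "p \<le> 2")
    case True
    have "s powr (p - 1) \<le> 1 + (p - 1) * (s - 1)"
      using assms True s by (intro powr_le_tangent_at_1) auto
    then show ?thesis using True unfolding sp by (simp add: algebra_simps)
  next
    case False
    have "1 - (p - 2) * (s - 1) \<le> s powr (- (p - 2))"
      using False s by (intro powr_minus_ge_tangent_at_1) auto
    then have "(1 - (p - 2) * (s - 1)) * s powr (p - 1) \<le> s powr (- (p - 2)) * s powr (p - 1)"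
      by (intro mult_right_mono) auto
    also have "\<dots> = s" using s by (simp add: powr_add[symmetric])
    finally show ?thesis using False unfolding sp by (simp add: algebra_simps)
  qed
qed

text \<open>The factor \<open>q - max 1 (p - 1)\<close> is the minimum of \<open>q - 1\<close> and
  \<open>q - p + 1\<close>. For \<open>q > 1\<close> it is therefore non-negative iff
  \<open>p \<le> q + 1\<close> and positive iff \<open>p < q + 1\<close>, which is where the two
  thresholds come from.\<close>

lemma scalar_picone_lower_bound:
  fixes s p q :: real
  assumes "p > 1" "0 \<le> s"
  shows "(q - max 1 (p - 1)) * ((s powr (p - 1) - 1) * (s - 1))
    \<le> (q - 1) * s powr p + (q - p + 1) - (q * s powr (p - 1) + (q - p) * s)"
  using powr_convexity_gap_le[OF assms] unfolding powr_mult_self[OF assms(2), of p, symmetric]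
  by (simp add: algebra_simps)

lemma scalar_picone_nonneg:
  fixes s p q :: real
  assumes "p > 1" "q > 1" "p \<le> q + 1" "0 \<le> s"
  shows "0 \<le> (q - 1) * s powr p + (q - p + 1) - (q * s powr (p - 1) + (q - p) * s)"
proof -
  have "0 \<le> (s powr (p - 1) - 1) * (s - 1)"
    using powr_minus_1_times_minus_1_pos[of "p - 1" s] assms by (cases "s = 1") auto
  then have "0 \<le> (q - max 1 (p - 1)) * ((s powr (p - 1) - 1) * (s - 1))"
    using assms by (intro mult_nonneg_nonneg[of "q - max 1 (p - 1)"]) auto
  then show ?thesis using scalar_picone_lower_bound[of p s q] assms by linarith
qed

lemma scalar_picone_pos:
  fixes s p q :: real
  assumes "p > 1" "q > 1" "p < q + 1" "0 \<le> s" "s \<noteq> 1"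
  shows "0 < (q - 1) * s powr p + (q - p + 1) - (q * s powr (p - 1) + (q - p) * s)"
proof -
  have "0 < (q - max 1 (p - 1)) * ((s powr (p - 1) - 1) * (s - 1))"
    using assms
    by (intro mult_pos_pos[of "q - max 1 (p - 1)"] powr_minus_1_times_minus_1_pos) auto
  then show ?thesis using scalar_picone_lower_bound[of p s q] assms by linarith
qed

section \<open>The gap as a function of two lengths and an inner product\<close>

text \<open>With \<open>x = v / u * \<bar>\<nabla>u\<bar>\<close>, \<open>y = \<bar>\<nabla>v\<bar>\<close> and \<open>z = v / u * (\<nabla>u \<bullet> \<nabla>v)\<close>, this is the
  difference of the two sides of the inequality up to the factor \<open>(v / u) powr (q - p)\<close>.\<close>

definition picone_gap :: "real \<Rightarrow> real \<Rightarrow> real \<Rightarrow> real \<Rightarrow> real \<Rightarrow> real" where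
  "picone_gap p q x y z = (q - 1) * x powr p + (q - p + 1) * y powr p
     - z * (q * x powr (p - 2) + (q - p) * y powr (p - 2))"

text \<open>The gap is homogeneous of degree \<open>p\<close> when \<open>z\<close> scales like
  \<open>x * y\<close>. Dividing by \<open>y\<close> leaves only the ratio \<open>x / y\<close> and
  the cosine \<open>c\<close>.\<close>

lemma picone_gap_homogeneous:
  assumes "0 \<le> x" "0 < y" "p > 1"
  shows "picone_gap p q x y (c * x * y) = y powr p *
    ((q - 1) * (x / y) powr p + (q - p + 1)
      - c * (q * (x / y) powr (p - 1) + (q - p) * (x / y)))"
proof -
  have x: "x powr (p - 2) * x = x powr (p - 1)" "x powr p = x powr (p - 1) * x"
    using powr_mult_self[of x "p - 1"] powr_mult_self[of x p] assms by auto
  have y: "y powr (p - 2) * y = y powr (p - 1)" "y powr p = y powr (p - 1) * y"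
    using powr_mult_self[of y "p - 1"] powr_mult_self[of y p] assms by auto
  have "picone_gap p q x y (c * x * y) = (q - 1) * x powr p + (q - p + 1) * y powr p
      - c * (q * ((x powr (p - 2) * x) * y) + (q - p) * ((y powr (p - 2) * y) * x))"
    unfolding picone_gap_def by (simp add: algebra_simps)
  also have "\<dots> = (q - 1) * x powr p + (q - p + 1) * y powr p
      - c * (q * (x powr (p - 1) * y) + (q - p) * (y powr (p - 1) * x))"
    unfolding x y by simp
  also have "\<dots> = y powr p * ((q - 1) * (x / y) powr p + (q - p + 1)
      - c * (q * (x / y) powr (p - 1) + (q - p) * (x / y)))"
    using assms unfolding powr_divide y
    by (simp add: field_simps)
  finally show ?thesis .
qed

lemma picone_gap_at_y_0:
  "picone_gap p q x 0 0 = (q - 1) * x powr p"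
  by (simp add: picone_gap_def)

text \<open>The quotient \<open>z / (x * y)\<close> is a cosine by Cauchy-Schwarz. If a length
  vanishes, the bound forces \<open>z = 0\<close>, and \<open>c = 0\<close> serves.\<close>

lemma cosine_cases:
  fixes x y z :: real
  assumes "0 \<le> x" "0 \<le> y" "\<bar>z\<bar> \<le> x * y"
  obtains c where "z = c * x * y" "\<bar>c\<bar> \<le> 1" "0 \<le> z \<Longrightarrow> 0 \<le> c"
proof (cases "x * y = 0")
  case True
  then show ?thesis using assms by (intro that[of 0]) auto
next
  case False
  then have "x * y > 0" using assms by (simp add: less_le)
  then show ?thesis using assms False
    by (intro that[of "z / (x * y)"]) (auto simp: abs_mult)
qed

lemma picone_gap_nonneg_I_set:
  assumes "p \<in> I_set q" "q > 1" "0 \<le> x" "0 \<le> y" "\<bar>z\<bar> \<le> x * y"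
  shows "0 \<le> picone_gap p q x y z"
proof (cases "y = 0")
  case True
  then show ?thesis using assms by (simp add: picone_gap_at_y_0)
next
  case False
  with assms have y: "y > 0" by simp
  have p: "p > 1" and I: "\<And>s. 0 \<le> s \<Longrightarrow>
      0 \<le> (q - 1) * s powr p + q * s powr (p - 1) - (p - q) * s + (q - p + 1)"
    using assms(1) unfolding I_set_def by auto
  \<comment> \<open>At \<open>s = 0\<close> both powers vanish, so membership in
    \<open>I_set q\<close> already contains the bound needed for the end point
    \<open>c = 1\<close>.\<close>
  have pq: "p \<le> q + 1" using I[of 0] p by simp
  obtain c where c: "z = c * x * y" "\<bar>c\<bar> \<le> 1" using cosine_cases assms by metis
  define s where "s = x / y"
  define A where "A = (q - 1) * s powr p + (q - p + 1)"
  define B where "B = q * s powr (p - 1) + (q - p) * s"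
  have s: "0 \<le> s" using assms by (simp add: s_def)
  have "0 \<le> A - B"
    using scalar_picone_nonneg[OF p assms(2) pq s] by (simp add: A_def B_def)
  moreover have "0 \<le> A + B"
    using I[OF s] by (simp add: A_def B_def algebra_simps)
  \<comment> \<open>The end points \<open>c = 1\<close> and \<open>c = - 1\<close> together bound
    \<open>B\<close>, which settles every cosine in between.\<close>
  ultimately have "\<bar>B\<bar> \<le> A" by linarith
  moreover have "c * B \<le> \<bar>B\<bar>"
    using c(2) mult_right_mono[of "\<bar>c\<bar>" 1 "\<bar>B\<bar>"] by (metis abs_ge_self abs_ge_zero abs_mult
        mult_1 order_trans)
  ultimately have "0 \<le> A - c * B" by linarith
  then show ?thesis
    unfolding c(1) picone_gap_homogeneous[OF assms(3) y p] s_def A_def B_def by simp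
qed

lemma picone_gap_nonneg:
  assumes "p > 1" "q > 1" "p \<le> q + 1" "0 \<le> x" "0 \<le> y" "0 \<le> z" "z \<le> x * y"
  shows "0 \<le> picone_gap p q x y z"
    and "p < q + 1 \<Longrightarrow> picone_gap p q x y z = 0 \<Longrightarrow> x = y \<and> z = x * y"
proof -
  have "0 \<le> picone_gap p q x y z \<and>
      (p < q + 1 \<longrightarrow> picone_gap p q x y z = 0 \<longrightarrow> x = y \<and> z = x * y)"
  proof (cases "y = 0")
    case True
    then show ?thesis using assms by (auto simp: picone_gap_at_y_0)
  next
    case False
    with assms have y: "y > 0" by simp
    obtain c where c: "z = c * x * y" "c \<le> 1" "0 \<le> c"
      using cosine_cases[of x y z] assms by (metis abs_le_D1 abs_of_nonneg)
    define s where "s = x / y"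
    define A where "A = (q - 1) * s powr p + (q - p + 1)"
    define B where "B = q * s powr (p - 1) + (q - p) * s"
    have s: "0 \<le> s" using assms by (simp add: s_def)
    have AB: "0 \<le> A - B"
      using scalar_picone_nonneg[OF assms(1-3) s] by (simp add: A_def B_def)
    have A: "0 \<le> A" using assms s by (simp add: A_def)
    \<comment> \<open>As \<open>0 \<le> c \<le> 1\<close>, the bracket is a convex combination of
      the values \<open>A\<close> at \<open>c = 0\<close> and \<open>A - B\<close> at
      \<open>c = 1\<close>; both are non-negative.\<close>
    have gap: "picone_gap p q x y z = y powr p * ((1 - c) * A + c * (A - B))"
      unfolding c(1) picone_gap_homogeneous[OF assms(4) y assms(1)] s_def A_def B_def
      by (simp add: algebra_simps)
    have nonneg: "0 \<le> (1 - c) * A" "0 \<le> c * (A - B)" using c A AB by simp_all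
    have "x = y \<and> z = x * y" if pq: "p < q + 1" and "picone_gap p q x y z = 0"
    proof -
      have "(1 - c) * A + c * (A - B) = 0" using gap that y by simp
      then have eq: "(1 - c) * A = 0" "c * (A - B) = 0" using nonneg by linarith+
      \<comment> \<open>Strictness of \<open>p < q + 1\<close> makes the value at
        \<open>c = 0\<close> positive, so a zero gap forces \<open>c = 1\<close> and then
        \<open>s = 1\<close>.\<close>
      have "0 \<le> (q - 1) * s powr p" using assms by simp
      then have "A > 0" using pq unfolding A_def by linarith
      then have c1: "c = 1" using eq by simp
      then have "A - B = 0" using eq by simp
      then have "s = 1"
        using scalar_picone_pos[OF assms(1,2) pq s] unfolding A_def B_def by fastforce
      then show ?thesis using c c1 y by (simp add: s_def)
    qed
    then show ?thesis using gap nonneg by simp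
  qed
  then show "0 \<le> picone_gap p q x y z"
    and "p < q + 1 \<Longrightarrow> picone_gap p q x y z = 0 \<Longrightarrow> x = y \<and> z = x * y" by auto
qed

section \<open>Gradients of the quotients and the pointwise identity\<close>

lemma GDERIV_powr_const:
  assumes "GDERIV f x :> D" "f x > 0"
  shows "GDERIV (\<lambda>y. f y powr r) x :> (r * f x powr (r - 1)) *\<^sub>R D"
  by (rule GDERIV_DERIV_compose[OF assms(1)]) (rule has_real_derivative_powr[OF assms(2)])

text \<open>Both quotients of the inequality have this shape, with \<open>r = q\<close> on the left
  and \<open>r = q - p + 1\<close> on the right. The quotient is homogeneous of degree one in
  \<open>(u, v)\<close>, so the coefficients depend on \<open>v / u\<close> alone.\<close>

lemma GDERIV_powr_divide_powr:
  assumes u: "GDERIV u x :> a" and v: "GDERIV v x :> b" and pos: "u x > 0" "v x > 0"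
  shows "GDERIV (\<lambda>y. v y powr r / u y powr (r - 1)) x :>
    (r * (v x / u x) powr (r - 1)) *\<^sub>R b - ((r - 1) * (v x / u x) powr r) *\<^sub>R a"
proof -
  have "GDERIV (\<lambda>y. v y powr r * u y powr (1 - r)) x :>
      v x powr r *\<^sub>R ((1 - r) * u x powr (1 - r - 1)) *\<^sub>R a
      + u x powr (1 - r) *\<^sub>R (r * v x powr (r - 1)) *\<^sub>R b"
    by (intro GDERIV_mult GDERIV_powr_const u v pos)
  moreover have "(\<lambda>y. v y powr r * u y powr (1 - r)) = (\<lambda>y. v y powr r / u y powr (r - 1))"
    using powr_minus_divide[of _ "r - 1"] by (auto simp: fun_eq_iff)
  moreover have "v x powr r *\<^sub>R ((1 - r) * u x powr (1 - r - 1)) *\<^sub>R a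
      + u x powr (1 - r) *\<^sub>R (r * v x powr (r - 1)) *\<^sub>R b =
      (r * (v x / u x) powr (r - 1)) *\<^sub>R b - ((r - 1) * (v x / u x) powr r) *\<^sub>R a"
  proof -
    have "u x powr (1 - r - 1) = 1 / u x powr r"
      using powr_minus_divide[of "u x" r] by simp
    then have A: "v x powr r * ((1 - r) * u x powr (1 - r - 1)) = - ((r - 1) * (v x / u x) powr r)"
      by (simp add: powr_divide minus_divide_left[symmetric] left_diff_distrib right_diff_distrib
          diff_divide_distrib mult.commute)
    have "u x powr (1 - r) = 1 / u x powr (r - 1)"
      using powr_minus_divide[of "u x" "r - 1"] by simp
    then have B: "u x powr (1 - r) * (r * v x powr (r - 1)) = r * (v x / u x) powr (r - 1)"
      by (simp add: powr_divide)
    show ?thesis unfolding scaleR_scaleR A B by simp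
  qed
  ultimately show ?thesis by simp
qed

lemma picone_rhs_minus_lhs:
  fixes x :: "real ^ 'n"
  assumes u: "u differentiable (at x)" "u x > 0" and v: "v differentiable (at x)" "v x > 0"
    and "p > 1"
  shows "picone_rhs p q u v x - picone_lhs p q u v x = (v x / u x) powr (q - p) *
    picone_gap p q (norm ((v x / u x) *\<^sub>R grad u x)) (norm (grad v x))
      (((v x / u x) *\<^sub>R grad u x) \<bullet> grad v x)"
proof -
  define a where "a = grad u x"
  define b where "b = grad v x"
  define t where "t = v x / u x"
  define z where "z = a \<bullet> b"
  have t: "t > 0" using u v by (simp add: t_def)
  note D = GDERIV_powr_divide_powr[OF gderiv_grad[OF u(1)] gderiv_grad[OF v(1)] u(2) v(2)]
  have g1: "grad (\<lambda>y. v y powr q / u y powr (q - 1)) x =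
      (q * t powr (q - 1)) *\<^sub>R b - ((q - 1) * t powr q) *\<^sub>R a"
    unfolding a_def b_def t_def by (rule grad_eqI[OF D])
  have g2: "grad (\<lambda>y. v y powr (q - p + 1) / u y powr (q - p)) x =
      ((q - p + 1) * t powr (q - p)) *\<^sub>R b - ((q - p) * t powr (q - p + 1)) *\<^sub>R a"
    unfolding a_def b_def t_def using grad_eqI[OF D[of "q - p + 1"]] by simp
  \<comment> \<open>Once \<open>t powr (q - p)\<close> is split off, the remaining powers of
    \<open>t\<close> are those that turn \<open>a\<close> into \<open>t *\<^sub>R a\<close> inside
    the gap.\<close>
  have t_powr: "t powr (q - 1) = t powr (q - p) * (t powr (p - 2) * t)"
    "t powr q = t powr (q - p) * t powr p" "t powr (q - p + 1) = t powr (q - p) * t"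
    using t powr_mult_self[of t "p - 1"] powr_mult_self[of t "q - p + 1"]
    by (simp_all add: powr_add[symmetric])
  have lhs: "picone_lhs p q u v x = norm a powr (p - 2) * (q * t powr (q - 1)) * z
      - (q - 1) * t powr q * norm a powr p"
    unfolding picone_lhs_def g1 pflux_def a_def[symmetric]
    using powr_minus_2_mult_square[of "norm a" p, OF norm_ge_zero]
    by (simp add: inner_diff_right z_def dot_square_norm algebra_simps)
  have rhs: "picone_rhs p q u v x = (q - p + 1) * t powr (q - p) * norm b powr p
      - norm b powr (p - 2) * ((q - p) * t powr (q - p + 1)) * z"
    unfolding picone_rhs_def g2 pflux_def b_def[symmetric]
    using powr_minus_2_mult_square[of "norm b" p, OF norm_ge_zero]
    by (simp add: inner_diff_right z_def dot_square_norm inner_commute algebra_simps)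
  show ?thesis
    unfolding lhs rhs a_def[symmetric] b_def[symmetric] t_def[symmetric] picone_gap_def t_powr
    using t by (simp add: powr_mult z_def[symmetric] algebra_simps)
qed

lemma picone_le_iff:
  fixes x :: "real ^ 'n"
  assumes "u differentiable (at x)" "u x > 0" "v differentiable (at x)" "v x > 0" "p > 1"
  shows "picone_lhs p q u v x \<le> picone_rhs p q u v x \<longleftrightarrow>
      0 \<le> picone_gap p q (norm ((v x / u x) *\<^sub>R grad u x)) (norm (grad v x))
        (((v x / u x) *\<^sub>R grad u x) \<bullet> grad v x)"
    and "picone_lhs p q u v x = picone_rhs p q u v x \<longleftrightarrow>
      picone_gap p q (norm ((v x / u x) *\<^sub>R grad u x)) (norm (grad v x))
        (((v x / u x) *\<^sub>R grad u x) \<bullet> grad v x) = 0"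
proof -
  let ?w = "(v x / u x) powr (q - p)"
  let ?g = "picone_gap p q (norm ((v x / u x) *\<^sub>R grad u x)) (norm (grad v x))
        (((v x / u x) *\<^sub>R grad u x) \<bullet> grad v x)"
  have w: "?w > 0" using assms by simp
  note diff = picone_rhs_minus_lhs[OF assms, of q]
  have "picone_lhs p q u v x \<le> picone_rhs p q u v x \<longleftrightarrow> 0 \<le> ?w * ?g"
    unfolding diff[symmetric] by simp
  then show "picone_lhs p q u v x \<le> picone_rhs p q u v x \<longleftrightarrow> 0 \<le> ?g"
    unfolding zero_le_mult_iff using w by auto
  have "picone_lhs p q u v x = picone_rhs p q u v x \<longleftrightarrow> ?w * ?g = 0"
    unfolding diff[symmetric] by auto
  then show "picone_lhs p q u v x = picone_rhs p q u v x \<longleftrightarrow> ?g = 0"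
    unfolding mult_eq_0_iff using w by auto
qed

lemma pos_diff_onD:
  assumes "pos_diff_on \<Omega> u" "open \<Omega>" "x \<in> \<Omega>"
  shows "u differentiable (at x)" "u x > 0"
  using assms unfolding pos_diff_on_def differentiable_on_def
  by (metis at_within_open, metis)

section \<open>The equality case\<close>

text \<open>This is the gap of two equal vectors of length \<open>x\<close>; the coefficients cancel
  because \<open>(q - 1) + (q - p + 1) = q + (q - p)\<close>.\<close>

lemma picone_gap_diagonal:
  assumes "0 \<le> x" "p > 1"
  shows "picone_gap p q x x (x\<^sup>2) = 0"
  using powr_minus_2_mult_square[of x p] assms
  by (simp add: picone_gap_def algebra_simps)

lemma norm_eq_inner_eq_imp_eq:
  fixes a b :: "'a::real_inner"
  assumes "norm a = norm b" "a \<bullet> b = norm a * norm b"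
  shows "a = b"
  using assms norm_cauchy_schwarz_eq[of a b] by (cases "norm b = 0") auto

text \<open>The hypothesis says that \<open>v\<close> times the gradient of \<open>u\<close> equals
  \<open>u\<close> times the gradient of \<open>v\<close>, so the numerator in the quotient rule
  vanishes; connectedness turns the zero derivative into a constant.\<close>

lemma constant_quotient_of_gradients:
  fixes \<Omega> :: "(real ^ 'n) set"
  assumes "open \<Omega>" "connected \<Omega>" and u: "pos_diff_on \<Omega> u" and v: "pos_diff_on \<Omega> v"
    and eq: "\<And>x. x \<in> \<Omega> \<Longrightarrow> (v x / u x) *\<^sub>R grad u x = grad v x"
  shows "(\<lambda>x. u x / v x) constant_on \<Omega>"
proof (rule has_derivative_zero_connected_constant_on[where K = "{}"])
  have der: "((\<lambda>x. u x / v x) has_derivative (\<lambda>h. 0)) (at x)" if x: "x \<in> \<Omega>" for x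
  proof -
    note u' = pos_diff_onD[OF u assms(1) x] and v' = pos_diff_onD[OF v assms(1) x]
    have "((\<lambda>x. u x / v x) has_derivative
        (\<lambda>h. ((h \<bullet> grad u x) * v x - u x * (h \<bullet> grad v x)) / (v x * v x))) (at x)"
      using gderiv_grad[OF u'(1)] gderiv_grad[OF v'(1)] v'(2)
      unfolding gderiv_def by (intro has_derivative_divide') auto
    moreover have "(h \<bullet> grad u x) * v x - u x * (h \<bullet> grad v x) = 0" for h
      unfolding eq[OF x, symmetric] using u'(2) by simp
    ultimately show ?thesis by simp
  qed
  then show "continuous_on \<Omega> (\<lambda>x. u x / v x)"
    by (meson continuous_at_imp_continuous_on has_derivative_continuous)
  show "\<forall>x\<in>\<Omega> - {}. ((\<lambda>x. u x / v x) has_derivative (\<lambda>h. 0)) (at x within \<Omega>)"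
    using der has_derivative_at_withinI by blast
qed (use assms in auto)

lemma grad_proportional:
  fixes \<Omega> :: "(real ^ 'n) set"
  assumes "open \<Omega>" and v: "pos_diff_on \<Omega> v" and x: "x \<in> \<Omega>"
    and eq: "\<And>x. x \<in> \<Omega> \<Longrightarrow> u x = k * v x"
  shows "grad u x = k *\<^sub>R grad v x"
proof (rule grad_eqI)
  have "((\<lambda>y. k * v y) has_derivative (\<lambda>h. h \<bullet> (k *\<^sub>R grad v x))) (at x)"
    using gderiv_grad[OF pos_diff_onD(1)[OF v assms(1) x]]
    unfolding gderiv_def inner_scaleR_right by (rule has_derivative_mult_right)
  then show "GDERIV u x :> k *\<^sub>R grad v x"
    unfolding gderiv_def
    by (rule has_derivative_transform_within_open[OF _ assms(1) x]) (rule eq[symmetric])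
qed

lemma picone_equality_iff:
  fixes \<Omega> :: "(real ^ 'n) set"
  assumes "open \<Omega>" "connected \<Omega>" "\<Omega> \<noteq> {}" and p: "p > 1" and q: "q > 1"
    and u: "pos_diff_on \<Omega> u" and v: "pos_diff_on \<Omega> v" and pq: "p < q + 1"
    and nonneg: "\<forall>x\<in>\<Omega>. grad u x \<bullet> grad v x \<ge> 0"
  shows "(\<forall>x\<in>\<Omega>. picone_lhs p q u v x = picone_rhs p q u v x) \<longleftrightarrow>
    (\<exists>k>0. \<forall>x\<in>\<Omega>. u x = k * v x)" (is "?L \<longleftrightarrow> ?R")
proof
  assume L: ?L
  \<comment> \<open>A zero gap gives equal lengths and equality in Cauchy-Schwarz, hence equal
    vectors.\<close>
  have "(v x / u x) *\<^sub>R grad u x = grad v x" if x: "x \<in> \<Omega>" for x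
  proof -
    note u' = pos_diff_onD[OF u assms(1) x] and v' = pos_diff_onD[OF v assms(1) x]
    let ?a = "(v x / u x) *\<^sub>R grad u x" and ?b = "grad v x"
    have "picone_gap p q (norm ?a) (norm ?b) (?a \<bullet> ?b) = 0"
      using picone_le_iff(2)[OF u' v' p] L x by blast
    moreover have "0 \<le> ?a \<bullet> ?b" using nonneg x u' v' by simp
    ultimately have "norm ?a = norm ?b \<and> ?a \<bullet> ?b = norm ?a * norm ?b"
      using picone_gap_nonneg(2)[OF p q less_imp_le[OF pq] norm_ge_zero norm_ge_zero _
          norm_cauchy_schwarz pq] by blast
    then show ?thesis using norm_eq_inner_eq_imp_eq by blast
  qed
  then obtain k where k: "\<And>x. x \<in> \<Omega> \<Longrightarrow> u x / v x = k"
    using constant_quotient_of_gradients[OF assms(1,2) u v] unfolding constant_on_def by blast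
  obtain x0 where "x0 \<in> \<Omega>" using assms(3) by blast
  then have "k > 0"
    using k[of x0] pos_diff_onD(2)[OF u assms(1)] pos_diff_onD(2)[OF v assms(1)]
    by (metis divide_pos_pos)
  moreover have "u x = k * v x" if "x \<in> \<Omega>" for x
    using k[OF that] pos_diff_onD(2)[OF v assms(1) that] by (auto simp: field_simps)
  ultimately show ?R by blast
next
  assume ?R
  then obtain k where k: "k > 0" "\<And>x. x \<in> \<Omega> \<Longrightarrow> u x = k * v x" by blast
  show ?L
  proof
    fix x assume x: "x \<in> \<Omega>"
    note u' = pos_diff_onD[OF u assms(1) x] and v' = pos_diff_onD[OF v assms(1) x]
    \<comment> \<open>Here \<open>v / u\<close> is \<open>1 / k\<close>, which cancels the factor
      \<open>k\<close> of the gradient; what is left is the diagonal case.\<close>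
    have "(v x / u x) *\<^sub>R grad u x = grad v x"
      using grad_proportional[OF assms(1) v x k(2)] k x v' by simp
    then show "picone_lhs p q u v x = picone_rhs p q u v x"
      unfolding picone_le_iff(2)[OF u' v' p]
      using picone_gap_diagonal[of "norm (grad v x)" p q] p by (simp add: dot_square_norm)
  qed
qed

section \<open>Exponential counterexamples\<close>

lemma GDERIV_exp_inner:
  "GDERIV (\<lambda>y. exp (a \<bullet> (y - x0))) x :> exp (a \<bullet> (x - x0)) *\<^sub>R a"
  unfolding gderiv_def by (auto intro!: derivative_eq_intros simp: inner_commute)

lemma pos_diff_on_exp_inner:
  "pos_diff_on \<Omega> (\<lambda>y. exp (a \<bullet> (y - x0)))"
proof -
  have "(\<lambda>y. exp (a \<bullet> (y - x0))) differentiable (at x within \<Omega>)" for x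
    using GDERIV_exp_inner[of a x0 x] has_derivative_at_withinI
    unfolding gderiv_def differentiable_def by blast
  then show ?thesis unfolding pos_diff_on_def differentiable_on_def by simp
qed

text \<open>Exponentials are positive on all of space and have arbitrary gradients at \<open>x0\<close>, so a
  negative value of the gap at a single configuration of vectors refutes the inequality.\<close>

lemma picone_exp_violated:
  fixes a b x0 :: "real ^ 'n"
  assumes "p > 1" "picone_gap p q (norm a) (norm b) (a \<bullet> b) < 0"
  shows "\<not> picone_lhs p q (\<lambda>y. exp (a \<bullet> (y - x0))) (\<lambda>y. exp (b \<bullet> (y - x0))) x0
    \<le> picone_rhs p q (\<lambda>y. exp (a \<bullet> (y - x0))) (\<lambda>y. exp (b \<bullet> (y - x0))) x0"
proof -
  have grad: "grad (\<lambda>y. exp (c \<bullet> (y - x0))) x0 = c" for c :: "real ^ 'n"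
    using grad_eqI[OF GDERIV_exp_inner[of c x0 x0]] by simp
  have diff: "(\<lambda>y. exp (c \<bullet> (y - x0))) differentiable (at x0)" for c :: "real ^ 'n"
    using GDERIV_exp_inner[of c x0 x0] unfolding gderiv_def differentiable_def by blast
  show ?thesis
    using picone_le_iff(1)[OF diff _ diff _ assms(1), of a b q] assms(2) by (simp add: grad)
qed

section \<open>The inequality, its equality case and the optimality of the assumptions\<close>

theorem theorem1p8:
  fixes \<Omega> :: "(real ^ 'n) set" and p q :: real
  assumes "open \<Omega>" and "connected \<Omega>" and "\<Omega> \<noteq> {}"
    and "p > 1" and "q > 1"
  shows
    "(\<forall>u v. pos_diff_on \<Omega> u \<and> pos_diff_on \<Omega> v \<and>
        (p \<in> I_set q \<or> (p \<le> q + 1 \<and> (\<forall>x\<in>\<Omega>. grad u x \<bullet> grad v x \<ge> 0))) \<longrightarrow>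
        (\<forall>x\<in>\<Omega>. picone_lhs p q u v x \<le> picone_rhs p q u v x)) \<and>
     (\<forall>u v. pos_diff_on \<Omega> u \<and> pos_diff_on \<Omega> v \<and>
        p < q + 1 \<and> (\<forall>x\<in>\<Omega>. grad u x \<bullet> grad v x \<ge> 0) \<longrightarrow>
        ((\<forall>x\<in>\<Omega>. picone_lhs p q u v x = picone_rhs p q u v x) \<longleftrightarrow>
         (\<exists>k>0. \<forall>x\<in>\<Omega>. u x = k * v x))) \<and>
     (p \<notin> I_set q \<longrightarrow>
        (\<exists>u v. pos_diff_on \<Omega> u \<and> pos_diff_on \<Omega> v \<and>
          (\<exists>x\<in>\<Omega>. \<not> picone_lhs p q u v x \<le> picone_rhs p q u v x))) \<and>
     (p > q + 1 \<longrightarrow>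
        (\<exists>u v. pos_diff_on \<Omega> u \<and> pos_diff_on \<Omega> v \<and>
          (\<forall>x\<in>\<Omega>. grad u x \<bullet> grad v x \<ge> 0) \<and>
          (\<exists>x\<in>\<Omega>. \<not> picone_lhs p q u v x \<le> picone_rhs p q u v x)))"
proof (intro conjI allI impI)
  obtain x0 where x0: "x0 \<in> \<Omega>" using assms(3) by blast
  obtain e :: "real ^ 'n" where e: "norm e = 1" using vector_choose_size[of 1] by auto
  {
    fix u v
    assume asm: "pos_diff_on \<Omega> u \<and> pos_diff_on \<Omega> v \<and>
        (p \<in> I_set q \<or> (p \<le> q + 1 \<and> (\<forall>x\<in>\<Omega>. grad u x \<bullet> grad v x \<ge> 0)))"
    show "\<forall>x\<in>\<Omega>. picone_lhs p q u v x \<le> picone_rhs p q u v x"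
    proof
      fix x assume x: "x \<in> \<Omega>"
      have u': "u differentiable (at x)" "u x > 0" and v': "v differentiable (at x)" "v x > 0"
        using asm pos_diff_onD[OF _ assms(1) x] by auto
      let ?a = "(v x / u x) *\<^sub>R grad u x" and ?b = "grad v x"
      have "0 \<le> picone_gap p q (norm ?a) (norm ?b) (?a \<bullet> ?b)"
      proof (cases "p \<in> I_set q")
        case True
        then show ?thesis
          by (rule picone_gap_nonneg_I_set[OF _ assms(5) norm_ge_zero norm_ge_zero
                Cauchy_Schwarz_ineq2])
      next
        case False
        then have "p \<le> q + 1" "0 \<le> ?a \<bullet> ?b" using asm x u' v' by auto
        then show ?thesis
          by (rule picone_gap_nonneg(1)[OF assms(4,5) _ norm_ge_zero norm_ge_zero _
                norm_cauchy_schwarz])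
      qed
      then show "picone_lhs p q u v x \<le> picone_rhs p q u v x"
        unfolding picone_le_iff(1)[OF u' v' assms(4)] .
    qed
  next
    fix u v
    assume "pos_diff_on \<Omega> u \<and> pos_diff_on \<Omega> v \<and>
        p < q + 1 \<and> (\<forall>x\<in>\<Omega>. grad u x \<bullet> grad v x \<ge> 0)"
    then show "(\<forall>x\<in>\<Omega>. picone_lhs p q u v x = picone_rhs p q u v x) \<longleftrightarrow>
        (\<exists>k>0. \<forall>x\<in>\<Omega>. u x = k * v x)"
      using picone_equality_iff[OF assms] by blast
  next
    assume "p \<notin> I_set q"
    then obtain s where s: "0 \<le> s"
      "(q - 1) * s powr p + q * s powr (p - 1) - (p - q) * s + (q - p + 1) < 0"
      using assms(4) unfolding I_set_def by (auto simp: not_le)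
    \<comment> \<open>Opposite gradients \<open>s *\<^sub>R e\<close> and \<open>- e\<close> have
      cosine \<open>- 1\<close>, where the gap is exactly the expression defining
      \<open>I_set q\<close>.\<close>
    have "picone_gap p q s 1 (- s) < 0"
      using picone_gap_homogeneous[of s 1 p q "- 1"] s assms(4) by (simp add: algebra_simps)
    then have "picone_gap p q (norm (s *\<^sub>R e)) (norm (- e)) ((s *\<^sub>R e) \<bullet> (- e)) < 0"
      using e s(1) by (simp add: dot_square_norm)
    note violated = picone_exp_violated[OF assms(4) this, of x0]
    then show "\<exists>u v. pos_diff_on \<Omega> u \<and> pos_diff_on \<Omega> v \<and>
        (\<exists>x\<in>\<Omega>. \<not> picone_lhs p q u v x \<le> picone_rhs p q u v x)"
      by (intro exI conjI bexI[OF _ x0]) (rule pos_diff_on_exp_inner violated)+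
  next
    assume "p > q + 1"
    \<comment> \<open>With \<open>u\<close> constant only the term \<open>q - p + 1\<close>
      survives, which is negative, while the inner product of the gradients is zero
      everywhere.\<close>
    then have "picone_gap p q (norm (0 :: real ^ 'n)) (norm e) (0 \<bullet> e) < 0"
      using e by (simp add: picone_gap_def)
    note violated = picone_exp_violated[OF assms(4) this, of x0]
    have grad_0: "grad (\<lambda>y. exp (0 \<bullet> (y - x0))) x = 0" for x
      using grad_eqI[OF GDERIV_exp_inner[of 0 x0 x]] by simp
    have nonneg:
      "\<forall>x\<in>\<Omega>. grad (\<lambda>y. exp (0 \<bullet> (y - x0))) x \<bullet> grad (\<lambda>y. exp (e \<bullet> (y - x0))) x \<ge> 0"
      unfolding grad_0 by simp
    show "\<exists>u v. pos_diff_on \<Omega> u \<and> pos_diff_on \<Omega> v \<and>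
        (\<forall>x\<in>\<Omega>. grad u x \<bullet> grad v x \<ge> 0) \<and>
        (\<exists>x\<in>\<Omega>. \<not> picone_lhs p q u v x \<le> picone_rhs p q u v x)"
      by (intro exI conjI bexI[OF _ x0]) (rule pos_diff_on_exp_inner nonneg violated)+
  }
qed

end
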